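(* Let $S$ be a commutative monoid and $G$ a group. Then any polynomial map $f:S\to G$ of degree $1$ is a nonconstant affine multiplicative function, i.e. $f$ is nonconstant and is a multiplicative function multiplied by a constant in $G$ either on the left or on the right.
   Context: A function $h:S\to G$ is multiplicative if $h(s+t)=h(s)h(t)$ for all $s,t\in S$. Let $S$ be a nonempty commutative semigroup (written additively) and $G$ a group with identity $1_G$. A map $f:S\to G$ is a polynomial map of degree $-\infty$ if $f(s)=1_G$ for all $s$, and of degree $0$ if it is constant with value different from $1_G$. Thus degree $\le 0$ means constant. Inductively, for $d\in\{0,1,2,\dots\}$, $f$ is a polynomial map of degree $\le d+1$ if for every $s\in S$ both maps $L_s(f):t\mapsto f(s+t)f(t)^{-1}$ and $R_s(f):t\mapsto f(t)^{-1}f(s+t)$ from $S$ to $G$ are polynomial maps of degree $\le d$. The degree of a polynomial map is the least such $d\in\{-\infty,0,1,2,\dots\}$. A map is a polynomial map if it is a polynomial map of degree $\le d$ for some $d$. *)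

theory Defs
  imports "HOL-Algebra.Group" "HOL-Library.Option_ord"
begin

(* The operation of the semigroup S, additive in the mathematics, is the product of the
   record S. None of the definitions refers to its unit, so they make sense for semigroups. *)

definition left_diff ::
    "('a, 'm) monoid_scheme \<Rightarrow> ('b, 'n) monoid_scheme \<Rightarrow> 'a \<Rightarrow> ('a \<Rightarrow> 'b) \<Rightarrow> 'a \<Rightarrow> 'b"
  where "left_diff S G s f = (\<lambda>t. f (s \<otimes>\<^bsub>S\<^esub> t) \<otimes>\<^bsub>G\<^esub> inv\<^bsub>G\<^esub> (f t))"

definition right_diff ::
    "('a, 'm) monoid_scheme \<Rightarrow> ('b, 'n) monoid_scheme \<Rightarrow> 'a \<Rightarrow> ('a \<Rightarrow> 'b) \<Rightarrow> 'a \<Rightarrow> 'b"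
  where "right_diff S G s f = (\<lambda>t. inv\<^bsub>G\<^esub> (f t) \<otimes>\<^bsub>G\<^esub> f (s \<otimes>\<^bsub>S\<^esub> t))"

definition constant_map :: "('a, 'm) monoid_scheme \<Rightarrow> ('b, 'n) monoid_scheme \<Rightarrow> ('a \<Rightarrow> 'b) \<Rightarrow> bool"
  where "constant_map S G f \<longleftrightarrow> (\<exists>c\<in>carrier G. \<forall>s\<in>carrier S. f s = c)"

(* Degrees live in nat option: None is minus infinity and Some d is d. The order is that
   of Option_ord, in which None is the least element. *)
function poly_deg_le ::
    "('a, 'm) monoid_scheme \<Rightarrow> ('b, 'n) monoid_scheme \<Rightarrow> nat option \<Rightarrow> ('a \<Rightarrow> 'b) \<Rightarrow> bool"
  where
    "poly_deg_le S G None f \<longleftrightarrow>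
       f \<in> carrier S \<rightarrow> carrier G \<and> (\<forall>s\<in>carrier S. f s = \<one>\<^bsub>G\<^esub>)"
  | "poly_deg_le S G (Some 0) f \<longleftrightarrow>
       f \<in> carrier S \<rightarrow> carrier G \<and> constant_map S G f"
  | "poly_deg_le S G (Some (Suc d)) f \<longleftrightarrow>
       f \<in> carrier S \<rightarrow> carrier G \<and>
       (\<forall>s\<in>carrier S. poly_deg_le S G (Some d) (left_diff S G s f) \<and>
                      poly_deg_le S G (Some d) (right_diff S G s f))"
  by pat_completeness auto
termination
  by (relation "measure (\<lambda>(S, G, d, f). case d of None \<Rightarrow> 0 | Some n \<Rightarrow> n)") auto

definition polynomial_map :: "('a, 'm) monoid_scheme \<Rightarrow> ('b, 'n) monoid_scheme \<Rightarrow> ('a \<Rightarrow> 'b) \<Rightarrow> bool"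
  where "polynomial_map S G f \<longleftrightarrow> (\<exists>d. poly_deg_le S G d f)"

(* Only meaningful when polynomial_map S G f holds. *)
definition poly_degree :: "('a, 'm) monoid_scheme \<Rightarrow> ('b, 'n) monoid_scheme \<Rightarrow> ('a \<Rightarrow> 'b) \<Rightarrow> nat option"
  where "poly_degree S G f = (LEAST d. poly_deg_le S G d f)"

(* Multiplicative functions from S to G are the elements of hom S G. *)
definition affine_multiplicative ::
    "('a, 'm) monoid_scheme \<Rightarrow> ('b, 'n) monoid_scheme \<Rightarrow> ('a \<Rightarrow> 'b) \<Rightarrow> bool"
  where "affine_multiplicative S G f \<longleftrightarrow>
    (\<exists>h\<in>hom S G. \<exists>c\<in>carrier G.
       (\<forall>s\<in>carrier S. f s = c \<otimes>\<^bsub>G\<^esub> h s) \<or> (\<forall>s\<in>carrier S. f s = h s \<otimes>\<^bsub>G\<^esub> c))"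

(* The side on which the constant stands is immaterial: conjugate h by c. *)
lemma affine_multiplicative_left_iff_right:
  assumes "group G"
  shows "(\<exists>h\<in>hom S G. \<exists>c\<in>carrier G. \<forall>s\<in>carrier S. f s = c \<otimes>\<^bsub>G\<^esub> h s) \<longleftrightarrow>
         (\<exists>h\<in>hom S G. \<exists>c\<in>carrier G. \<forall>s\<in>carrier S. f s = h s \<otimes>\<^bsub>G\<^esub> c)"
proof -
  interpret group G by fact
  have conj_hom: "(\<lambda>s. c \<otimes>\<^bsub>G\<^esub> h s \<otimes>\<^bsub>G\<^esub> inv\<^bsub>G\<^esub> c) \<in> hom S G" if "h \<in> hom S G" "c \<in> carrier G" for h c
    using that by (auto simp: hom_def Pi_iff m_assoc inv_solve_left)
  show ?thesis
  proof (intro iffI; elim bexE)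
    fix h c assume h: "h \<in> hom S G" and c: "c \<in> carrier G"
      and f: "\<forall>s\<in>carrier S. f s = c \<otimes>\<^bsub>G\<^esub> h s"
    have "\<forall>s\<in>carrier S. f s = (c \<otimes>\<^bsub>G\<^esub> h s \<otimes>\<^bsub>G\<^esub> inv\<^bsub>G\<^esub> c) \<otimes>\<^bsub>G\<^esub> c"
      using f h c by (auto simp: m_assoc hom_def Pi_iff)
    then show "\<exists>h\<in>hom S G. \<exists>c\<in>carrier G. \<forall>s\<in>carrier S. f s = h s \<otimes>\<^bsub>G\<^esub> c"
      using conj_hom[OF h c] c by (intro bexI[of _ "\<lambda>s. c \<otimes>\<^bsub>G\<^esub> h s \<otimes>\<^bsub>G\<^esub> inv\<^bsub>G\<^esub> c"] bexI[of _ c])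
  next
    fix h c assume h: "h \<in> hom S G" and c: "c \<in> carrier G"
      and f: "\<forall>s\<in>carrier S. f s = h s \<otimes>\<^bsub>G\<^esub> c"
    have "\<forall>s\<in>carrier S. f s = c \<otimes>\<^bsub>G\<^esub> (inv\<^bsub>G\<^esub> c \<otimes>\<^bsub>G\<^esub> h s \<otimes>\<^bsub>G\<^esub> c)"
      using f h c by (auto simp: m_assoc[symmetric] hom_def Pi_iff)
    then show "\<exists>h\<in>hom S G. \<exists>c\<in>carrier G. \<forall>s\<in>carrier S. f s = c \<otimes>\<^bsub>G\<^esub> h s"
      using conj_hom[OF h, of "inv\<^bsub>G\<^esub> c"] c
      by (intro bexI[of _ "\<lambda>s. inv\<^bsub>G\<^esub> c \<otimes>\<^bsub>G\<^esub> h s \<otimes>\<^bsub>G\<^esub> c"] bexI[of _ c]) auto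
  qed
qed

end

theory Submission
  imports Defs
begin

text \<open>
  Degree at most 1 says that the left difference \<open>t \<mapsto> f (s + t) f(t)\<^sup>-\<^sup>1\<close> does not depend on \<open>t\<close>.
  In a monoid its value can be read off at \<open>t = 0\<close>, where it is \<open>h s = f(s) f(0)\<^sup>-\<^sup>1\<close>. Hence
  \<open>f (s + t) = h s f(t)\<close> for all \<open>s\<close> and \<open>t\<close>; multiplying by \<open>f(0)\<^sup>-\<^sup>1\<close> on the right turns this into
  the multiplicativity of \<open>h\<close>, and \<open>f = h f(0)\<close>. The map is nonconstant because a constant map has
  degree at most 0.
\<close>

lemma poly_degree_least:
  assumes "poly_deg_le S G e f"
  shows "poly_degree S G f \<le> e"
  unfolding poly_degree_def by (rule Least_le) (fact assms)

lemma poly_deg_le_poly_degree: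
  assumes "polynomial_map S G f"
  shows "poly_deg_le S G (poly_degree S G f) f"
  using assms unfolding polynomial_map_def poly_degree_def by (auto intro: LeastI)

text \<open>
  Comparing the left difference at \<open>t\<close> with the one at \<open>0\<close> gives \<open>f (s + t) = h s f(t)\<close>. Left
  differences put the constant \<open>f(0)\<close> of the affine form on the right.
\<close>

lemma affine_multiplicative_if_left_diff_constant:
  assumes "monoid S" and "group G"
    and f: "f \<in> carrier S \<rightarrow> carrier G"
    and const: "\<And>s. s \<in> carrier S \<Longrightarrow> constant_map S G (left_diff S G s f)"
  shows "affine_multiplicative S G f"
proof -
  interpret S: monoid S by fact
  interpret G: group G by fact
  define c where "c = f \<one>\<^bsub>S\<^esub>"
  define h where "h s = f s \<otimes>\<^bsub>G\<^esub> inv\<^bsub>G\<^esub> c" for s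
  have f_closed: "f s \<in> carrier G" if "s \<in> carrier S" for s
    using f that by blast
  have c: "c \<in> carrier G"
    by (simp add: c_def f_closed)
  have h_closed: "h s \<in> carrier G" if "s \<in> carrier S" for s
    using that c f_closed by (simp add: h_def)
  have shift: "f (s \<otimes>\<^bsub>S\<^esub> t) = h s \<otimes>\<^bsub>G\<^esub> f t" if s: "s \<in> carrier S" and t: "t \<in> carrier S" for s t
  proof -
    have "left_diff S G s f t = left_diff S G s f \<one>\<^bsub>S\<^esub>"
      using const[OF s] t by (auto simp: constant_map_def)
    then have "f (s \<otimes>\<^bsub>S\<^esub> t) \<otimes>\<^bsub>G\<^esub> inv\<^bsub>G\<^esub> f t = h s"
      using s by (simp add: left_diff_def h_def c_def)
    then show ?thesis
      using s t f_closed h_closed by (simp add: G.inv_solve_right')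
  qed
  have "h \<in> hom S G"
  proof (rule homI)
    show "h s \<in> carrier G" if "s \<in> carrier S" for s
      using that by (rule h_closed)
    show "h (s \<otimes>\<^bsub>S\<^esub> t) = h s \<otimes>\<^bsub>G\<^esub> h t" if s: "s \<in> carrier S" and t: "t \<in> carrier S" for s t
    proof -
      have "h (s \<otimes>\<^bsub>S\<^esub> t) = (h s \<otimes>\<^bsub>G\<^esub> f t) \<otimes>\<^bsub>G\<^esub> inv\<^bsub>G\<^esub> c"
        using shift[OF s t] by (simp add: h_def)
      also have "\<dots> = h s \<otimes>\<^bsub>G\<^esub> h t"
        using G.m_assoc[of "h s" "f t" "inv\<^bsub>G\<^esub> c"] h_closed[OF s] f_closed[OF t] c
        by (simp add: h_def)
      finally show ?thesis .
    qed
  qed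
  moreover have "f s = h s \<otimes>\<^bsub>G\<^esub> c" if "s \<in> carrier S" for s
    using that c f_closed by (simp add: h_def G.m_assoc)
  ultimately show ?thesis
    using c unfolding affine_multiplicative_def by blast
qed

theorem proposition1:
  fixes S :: "('a, 'm) monoid_scheme" and G :: "('b, 'n) monoid_scheme"
    and f :: "'a \<Rightarrow> 'b"
  assumes "comm_monoid S" and "group G"
    and "polynomial_map S G f" and "poly_degree S G f = Some 1"
  shows "\<not> constant_map S G f \<and> affine_multiplicative S G f"
proof
  have "poly_deg_le S G (Some (Suc 0)) f"
    using poly_deg_le_poly_degree[OF assms(3)] assms(4) by simp
  then have f: "f \<in> carrier S \<rightarrow> carrier G"
    and const: "\<And>s. s \<in> carrier S \<Longrightarrow> constant_map S G (left_diff S G s f)"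
    by auto
  show "\<not> constant_map S G f"
  proof
    assume "constant_map S G f"
    with f have "poly_deg_le S G (Some 0) f"
      by simp
    then have "Some 1 \<le> Some (0::nat)"
      using poly_degree_least[of S G "Some 0" f] assms(4) by simp
    then show False
      by simp
  qed
  show "affine_multiplicative S G f"
    using comm_monoid.axioms(1)[OF assms(1)] assms(2) f const
    by (rule affine_multiplicative_if_left_diff_constant)
qed

end
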